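(* Let $g\ge2$ be an integer. Let $S_n\subseteq\{1,\dots,n\}$ ($n=1,2,\dots$) be a sequence of $B^\ast[g]$ sets that becomes uniformly distributed as $n\to\infty$. Then $|S_n|\lesssim 1.15988\sqrt{gn}$, that is, $\limsup_{n\to\infty}\frac{|S_n|}{1.15988\sqrt{gn}}\le1$.
   Context: A set $S$ of integers is called a $B^\ast[g]$ set if for every integer $m$ there are at most $g$ ordered pairs $(s_1,s_2)\in S\times S$ with $s_1+s_2=m$. A sequence $(S_n)_{n\ge1}$ of (nonempty finite) sets of positive integers becomes uniformly distributed if $$\limsup_{n\to\infty}\ \sup_{0\le\alpha<\beta\le1}\left|\frac{|S_n\cap[\alpha M_n,\beta M_n]|}{|S_n|}-(\beta-\alpha)\right|=0,$$ where $M_n$ denotes the largest element of $S_n$. *)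

theory Defs
  imports "HOL-Analysis.Analysis"
begin

text \<open>
  For infinite \<open>S\<close> the set of representations of \<open>m\<close> may be infinite, in which case \<open>card\<close> would
  return \<open>0\<close>; hence the explicit finiteness requirement.
\<close>

definition B_star :: "nat \<Rightarrow> int set \<Rightarrow> bool" where
  "B_star g S \<longleftrightarrow>
     (\<forall>m. finite {(s1, s2). s1 \<in> S \<and> s2 \<in> S \<and> s1 + s2 = m} \<and>
          card {(s1, s2). s1 \<in> S \<and> s2 \<in> S \<and> s1 + s2 = m} \<le> g)"

text \<open>
  Meaningful only for nonempty finite sets of positive integers (for all indices \<open>n \<ge> 1\<close>).
  The supremum and the upper limit are taken in the complete lattice of extended reals.
\<close>

definition discrepancy :: "int set \<Rightarrow> ereal" where
  "discrepancy S =
     (SUP (\<alpha>, \<beta>) \<in> {(\<alpha> :: real, \<beta> :: real). 0 \<le> \<alpha> \<and> \<alpha> < \<beta> \<and> \<beta> \<le> 1}.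
        ereal \<bar>real (card {s \<in> S. real_of_int s \<in> {\<alpha> * real_of_int (Max S)..\<beta> * real_of_int (Max S)}})
                 / real (card S) - (\<beta> - \<alpha>)\<bar>)"

definition becomes_uniformly_distributed :: "(nat \<Rightarrow> int set) \<Rightarrow> bool" where
  "becomes_uniformly_distributed S \<longleftrightarrow> limsup (\<lambda>n. discrepancy (S n)) = 0"

end

theory Submission
  imports Defs
begin

text \<open>
  The bound comes from counting sums near the largest element \<open>M\<close> of a set \<open>S\<close> whose
  discrepancy is at most \<open>\<delta>\<close>. The sum of two independent uniform variables on \<open>[0, 1]\<close> has a
  triangular density with peak value \<open>1\<close> at \<open>1\<close>, so the window \<open>[(1 - \<epsilon>) M, M]\<close>
  should receive about \<open>\<epsilon> |S|\<^sup>2\<close> of the \<open>|S|\<^sup>2\<close> sums \<open>s + t\<close>. Indeed, \<open>S\<close> has at least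
  \<open>(1 - \<epsilon> - \<delta>) |S|\<close> elements \<open>s \<le> (1 - \<epsilon>) M\<close>, and each of them has at least
  \<open>(\<epsilon> - \<delta>) |S|\<close> partners \<open>t\<close>, because these are the elements of \<open>S\<close> in an interval of length \<open>\<epsilon> M\<close>
  inside \<open>[0, M]\<close>. On the other hand the window contains at most \<open>\<epsilon> M + 1\<close> integers, and
  each is a sum at most \<open>g\<close> times. This gives
  \<open>(1 - \<epsilon> - \<delta>) (\<epsilon> - \<delta>) |S|\<^sup>2 \<le> g (\<epsilon> M + 1)\<close>, which is the lemma
  \<open>B_star_card_window_bound\<close>.

  For fixed \<open>\<epsilon>\<close> and \<open>\<delta> \<rightarrow> 0\<close> the size of \<open>S\<close> tends to infinity, hence so does \<open>M\<close>
  (lemma \<open>card_ge_of_discrepancy\<close>), and the right-hand side is asymptotically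
  \<open>g \<epsilon> M\<close>. Thus \<open>|S|\<^sup>2\<close> is asymptotically at most \<open>g M / (1 - \<epsilon>)\<close> for every
  \<open>\<epsilon> > 0\<close>. The constant \<open>1.15988\<^sup>2 = 1.3453\<dots>\<close> leaves enough room for the explicit choice
  \<open>\<epsilon> = 1/10\<close> and \<open>\<delta> = 1/200\<close>.
\<close>

lemma discrepancy_bound:
  assumes "discrepancy S \<le> ereal \<delta>" and "0 \<le> \<alpha>" and "\<alpha> < \<beta>" and "\<beta> \<le> 1"
  shows "\<bar>real (card {s \<in> S. real_of_int s \<in> {\<alpha> * real_of_int (Max S)..\<beta> * real_of_int (Max S)}})
            / real (card S) - (\<beta> - \<alpha>)\<bar> \<le> \<delta>"
proof -
  let ?d = "\<lambda>(\<alpha>, \<beta>). ereal \<bar>real (card {s \<in> S. real_of_int s \<in>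
      {\<alpha> * real_of_int (Max S)..\<beta> * real_of_int (Max S)}}) / real (card S) - (\<beta> - \<alpha>)\<bar>"
  have "?d (\<alpha>, \<beta>) \<le> discrepancy S"
    unfolding discrepancy_def by (rule SUP_upper) (use assms in simp)
  also note assms(1)
  finally show ?thesis by simp
qed

lemma card_interval_ge_of_discrepancy:
  assumes "discrepancy S \<le> ereal \<delta>" and "0 \<le> \<alpha>" and "\<alpha> < \<beta>" and "\<beta> \<le> 1"
    and "finite S" and "S \<noteq> {}"
  shows "(\<beta> - \<alpha> - \<delta>) * real (card S) \<le>
    real (card {s \<in> S. real_of_int s \<in> {\<alpha> * real_of_int (Max S)..\<beta> * real_of_int (Max S)}})"
proof -
  have "real (card S) > 0" using assms(5,6) by (simp add: card_gt_0_iff)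
  moreover have "\<beta> - \<alpha> - \<delta> \<le> real (card {s \<in> S. real_of_int s \<in>
      {\<alpha> * real_of_int (Max S)..\<beta> * real_of_int (Max S)}}) / real (card S)"
    using discrepancy_bound[OF assms(1-4)] by linarith
  ultimately show ?thesis by (simp add: pos_le_divide_eq)
qed

text \<open>
  A single point carries the proportion \<open>1 / |S|\<close> of \<open>S\<close>, and it lies in intervals that are
  arbitrarily short. Here the point is \<open>Max S\<close> and the interval has relative length \<open>\<delta>\<close>.
\<close>

lemma card_ge_of_discrepancy:
  assumes "discrepancy S \<le> ereal \<delta>" and "0 < \<delta>" and "\<delta> \<le> 1"
    and "finite S" and "S \<noteq> {}" and "S \<subseteq> {1..}"
  shows "1 \<le> 2 * \<delta> * real (card S)"
proof -
  let ?A = "{s \<in> S. real_of_int s \<in> {(1 - \<delta>) * real_of_int (Max S)..1 * real_of_int (Max S)}}"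
  have c: "real (card S) > 0" using assms(4,5) by (simp add: card_gt_0_iff)
  have M: "Max S \<in> S" using assms(4,5) by simp
  with assms(6) have "Max S \<ge> 1" by auto
  with M assms(2) have "Max S \<in> ?A" by (auto simp: algebra_simps)
  moreover have "finite ?A" using assms(4) by simp
  ultimately have "1 \<le> real (card ?A)"
    by (metis One_nat_def Suc_leI card_gt_0_iff empty_iff of_nat_1 of_nat_le_iff)
  moreover have "real (card ?A) / real (card S) \<le> 2 * \<delta>"
    using discrepancy_bound[OF assms(1), of "1 - \<delta>" 1] assms(2,3) by linarith
  ultimately show ?thesis using c by (simp add: pos_divide_le_eq)
qed

lemma B_star_card_window_bound:
  fixes S :: "int set" and \<epsilon> \<delta> :: real
  assumes B: "B_star g S" and D: "discrepancy S \<le> ereal \<delta>"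
    and fin: "finite S" and ne: "S \<noteq> {}" and pos: "S \<subseteq> {1..}"
    and \<epsilon>: "0 < \<epsilon>" "\<epsilon> < 1" "\<delta> \<le> \<epsilon>"
  shows "(1 - \<epsilon> - \<delta>) * (\<epsilon> - \<delta>) * (real (card S))\<^sup>2 \<le> real g * (\<epsilon> * real_of_int (Max S) + 1)"
proof -
  define M where "M = Max S"
  define T where "T = {s \<in> S. real_of_int s \<in> {0 * real_of_int M..(1 - \<epsilon>) * real_of_int M}}"
  define A where "A s = {t \<in> S. real_of_int t \<in> {(1 - \<epsilon> - s / M) * real_of_int M..
      (1 - s / M) * real_of_int M}}" for s :: int
  define R where "R m = {(s1, s2). s1 \<in> S \<and> s2 \<in> S \<and> s1 + s2 = m}" for m
  define W where "W = {\<lceil>(1 - \<epsilon>) * real_of_int M\<rceil>..M}"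
  have "M \<in> S" using fin ne by (simp add: M_def)
  with pos have M: "real_of_int M \<ge> 1" by auto
  have finT: "finite T" and finA: "finite (A s)" for s
    using fin by (simp_all add: T_def A_def)
  have cardT: "(1 - \<epsilon> - \<delta>) * real (card S) \<le> real (card T)"
    using card_interval_ge_of_discrepancy[OF D, of 0 "1 - \<epsilon>"] \<epsilon> fin ne
    by (simp add: T_def M_def)
  have cardA: "(\<epsilon> - \<delta>) * real (card S) \<le> real (card (A s))" if "s \<in> T" for s
  proof -
    have "0 \<le> real_of_int s" "real_of_int s \<le> (1 - \<epsilon>) * real_of_int M"
      using that by (auto simp: T_def)
    then have "0 \<le> 1 - \<epsilon> - s / M" "1 - s / M \<le> 1"
      using M by (simp_all add: field_simps)
    then show ?thesis
      using card_interval_ge_of_discrepancy[OF D, of "1 - \<epsilon> - s / M" "1 - s / M"] \<epsilon> fin ne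
      by (simp add: A_def M_def)
  qed
  have sub: "Sigma T A \<subseteq> (\<Union>m\<in>W. R m)"
  proof
    fix p assume "p \<in> Sigma T A"
    then obtain s t where p: "p = (s, t)" and s: "s \<in> T" and t: "t \<in> A s" by auto
    have "(a - s / M) * real_of_int M = a * real_of_int M - real_of_int s" for a
      using M by (simp add: left_diff_distrib)
    then have "(1 - \<epsilon>) * real_of_int M \<le> real_of_int (s + t)"
      and "real_of_int (s + t) \<le> real_of_int M"
      using t by (auto simp: A_def)
    then have "s + t \<in> W" by (simp add: W_def ceiling_le_iff)
    moreover have "p \<in> R (s + t)" using s t by (simp add: p R_def T_def A_def)
    ultimately show "p \<in> (\<Union>m\<in>W. R m)" by blast
  qed
  have finR: "finite (R m)" and cardR: "card (R m) \<le> g" for m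
    using B by (auto simp: B_star_def R_def)
  have finW: "finite W" by (simp add: W_def)
  have "(1 - \<epsilon>) * real_of_int M \<le> real_of_int M" using M \<epsilon> by (simp add: algebra_simps)
  then have "\<lceil>(1 - \<epsilon>) * real_of_int M\<rceil> \<le> M" by (simp add: ceiling_le_iff)
  then have "real (card W) = real_of_int (M - \<lceil>(1 - \<epsilon>) * real_of_int M\<rceil> + 1)"
    by (simp add: W_def)
  also have "\<dots> \<le> \<epsilon> * real_of_int M + 1"
    using le_of_int_ceiling[of "(1 - \<epsilon>) * real_of_int M"]
    by (simp add: left_diff_distrib, linarith)
  finally have cardW: "real (card W) \<le> \<epsilon> * real_of_int M + 1" .

  have "(1 - \<epsilon> - \<delta>) * (\<epsilon> - \<delta>) * (real (card S))\<^sup>2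
      = ((1 - \<epsilon> - \<delta>) * real (card S)) * ((\<epsilon> - \<delta>) * real (card S))"
    by (simp add: power2_eq_square)
  also have "\<dots> \<le> real (card T) * ((\<epsilon> - \<delta>) * real (card S))"
    using cardT \<epsilon> by (intro mult_right_mono) simp_all
  also have "\<dots> = (\<Sum>s\<in>T. (\<epsilon> - \<delta>) * real (card S))" by simp
  also have "\<dots> \<le> (\<Sum>s\<in>T. real (card (A s)))"
    by (rule sum_mono) (rule cardA)
  also have "\<dots> = real (card (Sigma T A))"
    using finT finA by (simp add: card_SigmaI)
  also have "\<dots> \<le> real (card (\<Union>m\<in>W. R m))"
    using sub finW finR by (intro of_nat_mono card_mono) simp_all
  also have "\<dots> \<le> real (\<Sum>m\<in>W. card (R m))"
    by (intro of_nat_mono card_UN_le finW)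
  also have "\<dots> \<le> real (\<Sum>m\<in>W. g)"
    by (intro of_nat_mono sum_mono cardR)
  also have "\<dots> = real g * real (card W)" by simp
  also have "\<dots> \<le> real g * (\<epsilon> * real_of_int M + 1)"
    using cardW by (intro mult_left_mono) simp_all
  finally show ?thesis by (simp add: M_def)
qed

lemma B_star_card_le_of_discrepancy:
  assumes B: "B_star g S" and D: "discrepancy S \<le> ereal (1/200)"
    and ne: "S \<noteq> {}" and sub: "S \<subseteq> {1..int n}"
  shows "real (card S) \<le> 1.15988 * sqrt (real g * real n)"
proof -
  have fin: "finite S" using sub finite_subset by blast
  have pos: "S \<subseteq> {1..}" using sub by auto
  define M where "M = Max S"
  have "M \<in> S" using fin ne by (simp add: M_def)
  with sub have M: "1 \<le> M" "M \<le> int n" by auto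
  have "S \<subseteq> {1..M}" using pos fin by (auto simp: M_def)
  then have "card S \<le> card {1..M}" by (intro card_mono) simp_all
  then have "real (card S) \<le> real_of_int M" using M by simp
  with card_ge_of_discrepancy[OF D _ _ fin ne pos] have M100: "100 \<le> real_of_int M" by simp
  have Mn: "real_of_int M \<le> real n" using M by linarith
  have "17 / 200 * (real (card S))\<^sup>2 \<le> (1 - 1/10 - 1/200) * (1/10 - 1/200) * (real (card S))\<^sup>2"
    by (intro mult_right_mono) simp_all
  also have "\<dots> \<le> real g * (1/10 * real_of_int M + 1)"
    using B_star_card_window_bound[OF B D fin ne pos, of "1/10"] by (simp add: M_def)
  \<comment> \<open>As \<open>M \<ge> 100\<close>, the summand \<open>1\<close> costs at most \<open>M / 100\<close>.\<close>
  also have "\<dots> \<le> real g * (11/100 * real n)"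
    using M100 Mn by (intro mult_left_mono) simp_all
  finally have "(real (card S))\<^sup>2 \<le> 22/17 * (real g * real n)" by simp
  also have "\<dots> \<le> 1.15988\<^sup>2 * (real g * real n)"
    by (intro mult_right_mono) (simp_all add: power2_eq_square)
  also have "\<dots> = (1.15988 * sqrt (real g * real n))\<^sup>2"
    by (simp only: power_mult_distrib) simp
  finally show ?thesis
    by (rule power2_le_imp_le) simp
qed

theorem theorem5p9:
  fixes g :: nat and S :: "nat \<Rightarrow> int set"
  assumes "g \<ge> 2"
    and "\<And>n. n \<ge> 1 \<Longrightarrow> S n \<noteq> {}"
    and "\<And>n. n \<ge> 1 \<Longrightarrow> S n \<subseteq> {1..int n}"
    and "\<And>n. n \<ge> 1 \<Longrightarrow> B_star g (S n)"
    and "becomes_uniformly_distributed S"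
  shows "limsup (\<lambda>n. ereal (real (card (S n)) / (1.15988 * sqrt (real g * real n)))) \<le> 1"
proof (rule Limsup_bounded)
  have "limsup (\<lambda>n. discrepancy (S n)) < ereal (1/200)"
    using assms(5) by (simp add: becomes_uniformly_distributed_def)
  then have "\<forall>\<^sub>F n in sequentially. discrepancy (S n) < ereal (1/200)"
    by (rule Limsup_lessD)
  then show "\<forall>\<^sub>F n in sequentially.
      ereal (real (card (S n)) / (1.15988 * sqrt (real g * real n))) \<le> 1"
    using eventually_ge_at_top[of 1]
  proof eventually_elim
    case (elim n)
    have "real (card (S n)) \<le> 1.15988 * sqrt (real g * real n)"
      using B_star_card_le_of_discrepancy[of g "S n" n] assms(2-4)[of n] elim by simp
    moreover have "0 < 1.15988 * sqrt (real g * real n)"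
      using assms(1) elim by simp
    ultimately have "real (card (S n)) / (1.15988 * sqrt (real g * real n)) \<le> 1"
      by (simp only: divide_le_eq_1_pos)
    then show ?case by (simp only: ereal_less_eq one_ereal_def)
  qed
qed

end
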